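(* Let $a>0$, $b>0$, $c>0$ and let $T$ be the set of lattice points $(x,y)\in\mathbb{Z}_{\ge0}^2$ with $ax+by\le c$. Call a lattice point white if $x+y$ is even and black if $x+y$ is odd. Then the maximum cardinality of a subset of $T$ in which no two points are horizontally or vertically adjacent (i.e., no two points at Euclidean distance $1$) equals the maximum of the number of white points of $T$ and the number of black points of $T$. *)

theory Defs
  imports Complex_Main
begin

definition triangle_points :: "real \<Rightarrow> real \<Rightarrow> real \<Rightarrow> (int \<times> int) set" where
  "triangle_points a b c =
     {(x, y). 0 \<le> x \<and> 0 \<le> y \<and> a * real_of_int x + b * real_of_int y \<le> c}"

definition white :: "int \<times> int \<Rightarrow> bool" where
  "white p \<longleftrightarrow> even (fst p + snd p)"

definition black :: "int \<times> int \<Rightarrow> bool" where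
  "black p \<longleftrightarrow> odd (fst p + snd p)"

definition adjacent :: "int \<times> int \<Rightarrow> int \<times> int \<Rightarrow> bool" where
  "adjacent p q \<longleftrightarrow>
     snd p = snd q \<and> \<bar>fst p - fst q\<bar> = 1 \<or> fst p = fst q \<and> \<bar>snd p - snd q\<bar> = 1"

definition independent_points :: "(int \<times> int) set \<Rightarrow> bool" where
  "independent_points S \<longleftrightarrow> (\<forall>p\<in>S. \<forall>q\<in>S. \<not> adjacent p q)"

(* Consequently, all cardinalities of subsets of the triangle, and the maximum over its
   (nonempty, finite) family of independent subsets, have their usual meaning. *)
lemma finite_triangle_points:
  assumes "a > 0" "b > 0"
  shows "finite (triangle_points a b c)"
proof (rule finite_subset)
  show "triangle_points a b c \<subseteq> {0..\<lfloor>c / a\<rfloor>} \<times> {0..\<lfloor>c / b\<rfloor>}"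
  proof
    fix p assume "p \<in> triangle_points a b c"
    then obtain x y where p: "p = (x, y)" and xy: "0 \<le> x" "0 \<le> y"
      and le: "a * real_of_int x + b * real_of_int y \<le> c"
      by (auto simp: triangle_points_def)
    have "0 \<le> a * real_of_int x" "0 \<le> b * real_of_int y"
      using xy assms by simp_all
    with le have "a * real_of_int x \<le> c" "b * real_of_int y \<le> c"
      by linarith+
    with assms have "real_of_int x \<le> c / a" "real_of_int y \<le> c / b"
      by (simp_all add: field_simps)
    with xy show "p \<in> {0..\<lfloor>c / a\<rfloor>} \<times> {0..\<lfloor>c / b\<rfloor>}"
      by (simp add: p le_floor_iff)
  qed
qed simp

end

theory Submission
  imports Defs
begin

text \<open>
  By symmetry assume \<open>a \<le> b\<close>. Then the row lengths strictly decrease upwards, so a row with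
  \<open>k\<close> nonempty rows above it has more than \<open>k\<close> points. It suffices to find
  an injection of the minority colour into the majority colour along edges of the grid. Matching
  each row horizontally leaves a surplus of at most one point, in the rows of odd length, and its
  colour is that of the leftmost point of the row. Surplus points of opposite colours are cancelled
  against each other by letting surplus flow downwards: a net flow of \<open>F\<close> into row \<open>i\<close> from above
  is realised by \<open>\<bar>F\<bar>\<close> vertical edges using the leftmost points of the right colour. At
  most half of the rows above contribute to the flow, so the rows are long enough to carry it.
\<close>

section \<open>Independent sets and matchings\<close>

text \<open>Exchange argument: independence of \<open>S\<close> keeps the images under
  \<open>f\<close> of its points outside \<open>Q\<close> out of \<open>S\<close>, so replacing
  those points by their images loses nothing.\<close>

lemma card_independent_le_matching:
  assumes fin: "finite T"
    and inj: "inj_on f {p \<in> T. \<not> Q p}"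
    and into: "\<And>p. p \<in> T \<Longrightarrow> \<not> Q p \<Longrightarrow> f p \<in> T \<and> Q (f p) \<and> adjacent p (f p)"
    and S: "S \<subseteq> T" "independent_points S"
  shows "card S \<le> card {p \<in> T. Q p}"
proof -
  let ?A = "{p \<in> S. Q p}" and ?B = "{p \<in> S. \<not> Q p}"
  have finS: "finite S" using fin S(1) by (rule finite_subset[rotated])
  have disj: "f p \<notin> S" if "p \<in> ?B" for p
  proof
    assume "f p \<in> S"
    moreover have "p \<in> S" "adjacent p (f p)" using that S(1) into[of p] by blast+
    ultimately show False using S(2) unfolding independent_points_def by blast
  qed
  have "card S = card (?A \<union> ?B)"
    by (rule arg_cong[where f = card]) auto
  also have "\<dots> = card ?A + card ?B"
    using finS by (intro card_Un_disjoint) auto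
  also have "card ?B = card (f ` ?B)"
    by (rule card_image[symmetric], rule inj_on_subset[OF inj]) (use S in auto)
  also have "card ?A + card (f ` ?B) = card (?A \<union> f ` ?B)"
    using finS disj by (intro card_Un_disjoint[symmetric]) auto
  also have "\<dots> \<le> card {p \<in> T. Q p}"
    using fin S into by (intro card_mono) auto
  finally show ?thesis .
qed

lemma card_interval_step:
  fixes i n :: int
  assumes "i < n"
  shows "int (card {k \<in> {i..<n}. Q k}) =
    int (card {k \<in> {i + 1..<n}. Q k}) + (if Q i then 1 else 0)"
proof -
  have "{k \<in> {i..<n}. Q k} =
      (if Q i then insert i {k \<in> {i + 1..<n}. Q k} else {k \<in> {i + 1..<n}. Q k})"
    using assms by (auto simp: order.order_iff_strict)
  moreover have "finite {k \<in> {i + 1..<n}. Q k}"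
    by (rule finite_subset[of _ "{i + 1..<n}"]) auto
  ultimately show ?thesis by simp
qed

section \<open>Matching in a staircase shape\<close>

definition row_shape :: "int \<Rightarrow> (int \<Rightarrow> int) \<Rightarrow> (int \<times> int) set" where
  "row_shape n l = {(x, y). 0 \<le> y \<and> y < n \<and> 0 \<le> x \<and> x < l y}"

text \<open>
  A point \<open>(x, y)\<close> has the majority colour iff \<open>x + y + e\<close> is even; \<open>gain i\<close> and \<open>loss i\<close> count the
  surpluses of the majority and the minority colour in the rows from \<open>i\<close> on.
\<close>

locale staircase_shape =
  fixes n :: int and l :: "int \<Rightarrow> int" and e :: int
  assumes antimono: "\<And>i j. 0 \<le> i \<Longrightarrow> i \<le> j \<Longrightarrow> j < n \<Longrightarrow> l j \<le> l i"
    and staircase: "\<And>i. 0 \<le> i \<Longrightarrow> i < n \<Longrightarrow> n - i \<le> l i"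
    and majority: "card {k \<in> {0..<n}. odd (l k) \<and> odd (k + e)} \<le>
      card {k \<in> {0..<n}. odd (l k) \<and> even (k + e)}"
begin

definition gain :: "int \<Rightarrow> int" where
  "gain i = int (card {k \<in> {i..<n}. odd (l k) \<and> even (k + e)})"

definition loss :: "int \<Rightarrow> int" where
  "loss i = int (card {k \<in> {i..<n}. odd (l k) \<and> odd (k + e)})"

text \<open>
  The uppermost \<open>gain 0 - loss 0\<close> surplus points of the majority colour stay unmatched. The net
  flow from row \<open>i\<close> to row \<open>i - 1\<close> is positive if it carries surplus of the majority colour.
\<close>

definition flow :: "int \<Rightarrow> int" where
  "flow i = max (gain i - (gain 0 - loss 0)) 0 - loss i"

text \<open>The number of points of row \<open>i\<close> on vertical edges. As the two flows differ
  by at most one, these are exactly the leftmost points; horizontal pairing starts right after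
  them.\<close>

definition prefix :: "int \<Rightarrow> int" where
  "prefix i = \<bar>flow i\<bar> + \<bar>flow (i + 1)\<bar>"

text \<open>The factor 2 arises because only every second point of a row has the right
  colour.\<close>

fun partner :: "int \<times> int \<Rightarrow> int \<times> int" where
  "partner (x, i) =
    (if x < 2 * flow (i + 1) then (x, i + 1)
     else if x < - 2 * flow i then (x, i - 1)
     else if even (x - prefix i) then (x + 1, i) else (x - 1, i))"

fun partner_inv :: "int \<times> int \<Rightarrow> int \<times> int" where
  "partner_inv (x, i) =
    (if x < 2 * flow i then (x, i - 1)
     else if x < - 2 * flow (i + 1) then (x, i + 1)
     else if even (x - prefix i) then (x + 1, i) else (x - 1, i))"

lemma gain_le:
  assumes "i \<le> n"
  shows "2 * gain i \<le> n - i + (if even (i + e) then 1 else 0)"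
  using assms
proof (induction i rule: int_le_induct)
  case (step i)
  have "gain (i - 1) = gain i + (if odd (l (i - 1)) \<and> even (i - 1 + e) then 1 else 0)"
    unfolding gain_def using card_interval_step[of "i - 1"] step.hyps by simp
  then show ?case using step by (auto split: if_splits)
qed (simp add: gain_def)

lemma flow_le: "flow i \<le> gain i"
  using majority unfolding flow_def loss_def gain_def by linarith

lemma flow_0: "flow 0 = 0"
  unfolding flow_def loss_def by simp

lemma flow_n: "flow n = 0"
  using majority unfolding flow_def loss_def gain_def by simp

text \<open>Each row adds its own surplus to the flow. The equality for odd \<open>l i\<close>
  belongs to a row whose surplus point stays unmatched: there the \<open>max\<close> in
  \<open>flow\<close> is 0 for both \<open>i\<close> and \<open>i + 1\<close>.\<close>

lemma flow_step:
  assumes "i < n"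
  shows "even (l i) \<and> flow i = flow (i + 1) \<or>
    odd (l i) \<and> even (i + e) \<and> (flow i = flow (i + 1) \<or> flow i = flow (i + 1) + 1) \<or>
    odd (l i) \<and> odd (i + e) \<and> flow i = flow (i + 1) - 1"
proof -
  have "gain i = gain (i + 1) + (if odd (l i) \<and> even (i + e) then 1 else 0)"
    "loss i = loss (i + 1) + (if odd (l i) \<and> odd (i + e) then 1 else 0)"
    unfolding gain_def loss_def using card_interval_step[OF assms] by auto
  then show ?thesis
    unfolding flow_def by (auto split: if_splits)
qed

text \<open>Parity of \<open>x\<close> closes the gap between twice one flow and the sum of two
  flows differing by one. The rest of the row has odd length only if a majority point stays
  unmatched; this rest then begins with the majority colour, so its minority points pair to the
  left.\<close>

lemma
  assumes i: "i < n" and x: "0 \<le> x" and black: "odd (x + i + e)"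
    and hor: "\<not> x < 2 * flow (i + 1)" "\<not> x < - 2 * flow i"
  shows prefix_le: "prefix i \<le> x"
    and even_row_length: "even (x - prefix i) \<Longrightarrow> even (l i - prefix i)"
proof -
  obtain f g where fg: "flow i = f" "flow (i + 1) = g" by blast
  note step = flow_step[OF i, unfolded fg]
  have "f = g \<or> f = g + 1 \<and> odd x \<or> f = g - 1 \<and> even x"
    using step black by auto
  then have "\<bar>f\<bar> + \<bar>g\<bar> \<le> x"
    using hor[unfolded fg] x by (elim disjE conjE; cases "0 \<le> g"; auto elim!: evenE oddE; presburger)
  then show "prefix i \<le> x"
    by (simp add: prefix_def fg)
  show "even (l i - prefix i)" if "even (x - prefix i)"
    using step black that unfolding prefix_def fg by auto
qed

text \<open>Sends \<open>partner_inv\<close> into a horizontal branch at the majority end of a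
  horizontal edge.\<close>

lemma prefix_le_imp:
  assumes i: "i < n" and white: "even (x + i + e)" and "prefix i \<le> x"
  shows "2 * flow i \<le> x" "- 2 * flow (i + 1) \<le> x"
proof -
  obtain f g where fg: "flow i = f" "flow (i + 1) = g" by blast
  have "f = g \<or> f = g + 1 \<and> even x \<or> f = g - 1 \<and> odd x"
    using flow_step[OF i] white unfolding fg by auto
  then have "2 * f \<le> x \<and> - 2 * g \<le> x"
    using assms(3) unfolding prefix_def fg by (elim disjE conjE; cases "0 \<le> g"; auto elim!: evenE oddE; presburger)
  then show "2 * flow i \<le> x" "- 2 * flow (i + 1) \<le> x"
    by (simp_all add: fg)
qed

lemma partner_correct:
  assumes p: "(x, i) \<in> row_shape n l" and black: "odd (x + i + e)"
  shows "partner (x, i) \<in> row_shape n l \<and>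
    even (fst (partner (x, i)) + snd (partner (x, i)) + e) \<and>
    adjacent (x, i) (partner (x, i)) \<and> partner_inv (partner (x, i)) = (x, i)"
proof -
  have bounds: "0 \<le> i" "i < n" "0 \<le> x" "x < l i"
    using p by (auto simp: row_shape_def)
  consider (up) "x < 2 * flow (i + 1)"
    | (down) "\<not> x < 2 * flow (i + 1)" "x < - 2 * flow i"
    | (hor) "\<not> x < 2 * flow (i + 1)" "\<not> x < - 2 * flow i"
    by blast
  then show ?thesis
  proof cases
    case up
    then have "i + 1 \<noteq> n" using flow_n bounds by auto
    then have i: "i + 1 < n" using bounds by simp
    \<comment> \<open>If \<open>i + e\<close> is odd, the bound of \<open>gain_le\<close> is larger
      by one, but then \<open>x\<close> is even and at most
      \<open>2 * flow (i + 1) - 2\<close>.\<close>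
    have "x < n - (i + 1)"
      using up flow_le[of "i + 1"] gain_le[of "i + 1"] i black bounds
      by (cases "even (i + e)") auto
    then have "x < l (i + 1)" using staircase[of "i + 1"] bounds i by simp
    then show ?thesis
      using up black bounds i by (auto simp: row_shape_def adjacent_def)
  next
    case down
    then have "i \<noteq> 0" using flow_0 bounds by auto
    then have i: "0 \<le> i - 1" using bounds by simp
    have "x < l (i - 1)" using antimono[of "i - 1" i] i bounds by simp
    \<comment> \<open>This rules out the first branch of \<open>partner_inv\<close>:
      \<open>flow i\<close> is negative here, so \<open>flow (i - 1)\<close> is at most 0.\<close>
    moreover have "\<not> x < 2 * flow (i - 1)"
    proof -
      have "flow (i - 1) \<le> flow i + 1" using flow_step[of "i - 1"] bounds by auto
      then show ?thesis using down bounds by presburger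
    qed
    ultimately show ?thesis
      using down black bounds i by (auto simp: row_shape_def adjacent_def)
  next
    case hor
    note le = prefix_le[OF bounds(2,3) black hor]
    show ?thesis
    proof (cases "even (x - prefix i)")
      case True
      have "x + 1 < l i"
        using even_row_length[OF bounds(2,3) black hor True] True bounds by presburger
      moreover have "2 * flow i \<le> x + 1" "- 2 * flow (i + 1) \<le> x + 1"
        using prefix_le_imp[of i "x + 1"] bounds black le by auto
      ultimately show ?thesis
        using True hor black bounds by (auto simp: row_shape_def adjacent_def)
    next
      case False
      then have "prefix i \<le> x - 1" using le by (cases "x = prefix i") auto
      moreover from this have "2 * flow i \<le> x - 1" "- 2 * flow (i + 1) \<le> x - 1"
        using prefix_le_imp[of i "x - 1"] bounds black by auto
      ultimately show ?thesis
        using False hor black bounds by (auto simp: row_shape_def adjacent_def)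
    qed
  qed
qed

lemma card_independent_le:
  assumes "finite (row_shape n l)" "S \<subseteq> row_shape n l" "independent_points S"
  shows "card S \<le> card {p \<in> row_shape n l. even (fst p + snd p + e)}"
proof (rule card_independent_le_matching[OF assms(1) _ _ assms(2,3)])
  show "inj_on partner {p \<in> row_shape n l. odd (fst p + snd p + e)}"
    by (rule inj_on_inverseI[where g = partner_inv]) (use partner_correct in fastforce)
  show "partner p \<in> row_shape n l \<and> even (fst (partner p) + snd (partner p) + e) \<and>
      adjacent p (partner p)"
    if "p \<in> row_shape n l" "odd (fst p + snd p + e)" for p
    using partner_correct[of "fst p" "snd p"] that by simp
qed

end

section \<open>Triangles as staircase shapes\<close>

lemma card_independent_le_steep:
  fixes a b c :: real
  assumes "0 < a" "a \<le> b"
    and S: "S \<subseteq> triangle_points a b c" "independent_points S"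
  shows "card S \<le> max (card {p \<in> triangle_points a b c. white p})
    (card {p \<in> triangle_points a b c. black p})"
proof -
  have b: "0 < b" using assms by simp
  define n where "n = \<lfloor>c / b\<rfloor> + 1"
  define l where "l y = \<lfloor>(c - b * real_of_int y) / a\<rfloor> + 1" for y
  have less_n: "y < n \<longleftrightarrow> b * real_of_int y \<le> c" for y
    using b unfolding n_def by (simp add: le_floor_iff pos_le_divide_eq mult.commute)
  have less_l: "x < l y \<longleftrightarrow> a * real_of_int x + b * real_of_int y \<le> c" for x y
    using assms(1) unfolding l_def by (simp add: le_floor_iff pos_le_divide_eq le_diff_eq mult.commute)
  have T: "triangle_points a b c = row_shape n l"
  proof -
    have "y < n" if "0 \<le> x" "a * real_of_int x + b * real_of_int y \<le> c" for x y
    proof -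
      have "0 \<le> a * real_of_int x" using that(1) assms(1) by simp
      then show ?thesis using that(2) unfolding less_n by linarith
    qed
    then show ?thesis
      unfolding triangle_points_def row_shape_def less_l by auto
  qed
  have antimono: "l j \<le> l i" if "i \<le> j" for i j
    unfolding l_def using that b assms(1) by (auto intro!: floor_mono divide_right_mono)
  have staircase: "n - i \<le> l i" if "i < n" for i
  proof -
    \<comment> \<open>Starting from \<open>(0, i)\<close>, going \<open>n - 1 - i\<close> steps
      right costs no more than going up to \<open>(0, n - 1)\<close>.\<close>
    have "a * real_of_int (n - 1 - i) \<le> b * real_of_int (n - 1 - i)"
      using that assms by (intro mult_right_mono) auto
    moreover have "b * real_of_int (n - 1) \<le> c"
      using less_n[of "n - 1"] by simp
    ultimately have "n - 1 - i < l i"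
      unfolding less_l by (simp add: algebra_simps)
    then show ?thesis by simp
  qed
  have fin: "finite (row_shape n l)"
    using finite_triangle_points[OF assms(1) b, of c] unfolding T .
  let ?gain = "\<lambda>e. card {k \<in> {0..<n}. odd (l k) \<and> even (k + e)}"
  let ?loss = "\<lambda>e. card {k \<in> {0..<n}. odd (l k) \<and> odd (k + e)}"
  have bound: "card S \<le> card {p \<in> row_shape n l. even (fst p + snd p + e)}"
    if "?loss e \<le> ?gain e" for e
  proof -
    interpret staircase_shape n l e
      using that antimono staircase by unfold_locales auto
    show ?thesis
      using card_independent_le fin S T by simp
  qed
  \<comment> \<open>\<open>e = 0\<close> makes white the majority colour, \<open>e = 1\<close>
    black; switching exchanges gain and loss, so one choice satisfies the locale.\<close>
  have "?loss 1 = ?gain 0" "?gain 1 = ?loss 0"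
    by simp_all
  then consider "?loss 0 \<le> ?gain 0" | "?loss 1 \<le> ?gain 1" by linarith
  then show ?thesis
  proof cases
    case 1
    from bound[OF this] show ?thesis unfolding T white_def by simp
  next
    case 2
    from bound[OF this] show ?thesis unfolding T black_def by simp
  qed
qed

lemma swap_triangle_points: "prod.swap ` triangle_points a b c = triangle_points b a c"
  unfolding triangle_points_def by (auto simp: add.commute image_iff)

lemma card_swap_image_filter:
  assumes "\<And>p. Q (prod.swap p) \<longleftrightarrow> Q p"
  shows "card {p \<in> prod.swap ` T. Q p} = card {p \<in> T. Q p}"
proof -
  have "{p \<in> prod.swap ` T. Q p} = prod.swap ` {p \<in> T. Q p}"
    using assms by auto
  then show ?thesis by (simp add: card_image)
qed

text \<open>Reflection in the diagonal exchanges \<open>a\<close> and \<open>b\<close> and preserves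
  adjacency and both colours.\<close>

lemma card_independent_le_max:
  fixes a b c :: real
  assumes "0 < a" "0 < b"
    and S: "S \<subseteq> triangle_points a b c" "independent_points S"
  shows "card S \<le> max (card {p \<in> triangle_points a b c. white p})
    (card {p \<in> triangle_points a b c. black p})"
proof (cases "a \<le> b")
  case True
  then show ?thesis using card_independent_le_steep assms by blast
next
  case False
  have "prod.swap ` S \<subseteq> triangle_points b a c"
    using S(1) unfolding swap_triangle_points[of a b c, symmetric] by (rule image_mono)
  moreover have "independent_points (prod.swap ` S)"
    using S(2) unfolding independent_points_def adjacent_def by fastforce
  ultimately have "card (prod.swap ` S) \<le> max (card {p \<in> triangle_points b a c. white p})
      (card {p \<in> triangle_points b a c. black p})"
    using False assms by (intro card_independent_le_steep) auto
  moreover have "white (prod.swap p) \<longleftrightarrow> white p" "black (prod.swap p) \<longleftrightarrow> black p" for p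
    by (simp_all add: white_def black_def add.commute)
  ultimately show ?thesis
    unfolding swap_triangle_points[of a b c, symmetric]
    by (simp add: card_image card_swap_image_filter)
qed

theorem theorem6:
  fixes a b c :: real
  assumes "a > 0" and "b > 0" and "c > 0"
  shows "Max {card S | S. S \<subseteq> triangle_points a b c \<and> independent_points S} =
         max (card {p \<in> triangle_points a b c. white p})
             (card {p \<in> triangle_points a b c. black p})"
proof (rule Max_eqI)
  have "{card S | S. S \<subseteq> triangle_points a b c \<and> independent_points S} \<subseteq>
      card ` Pow (triangle_points a b c)"
    by auto
  then show "finite {card S | S. S \<subseteq> triangle_points a b c \<and> independent_points S}"
    by (rule finite_subset) (simp add: finite_triangle_points assms)
  show "y \<le> max (card {p \<in> triangle_points a b c. white p})
      (card {p \<in> triangle_points a b c. black p})"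
    if "y \<in> {card S | S. S \<subseteq> triangle_points a b c \<and> independent_points S}" for y
    using that card_independent_le_max[OF assms(1,2)] by blast
  \<comment> \<open>Edges join opposite colours, so each colour class is independent and the larger
    one attains the bound.\<close>
  have odd_step: "even (u + v) \<noteq> even (u' + v')"
    if "adjacent (u, v) (u', v')" for u v u' v'
    using that unfolding adjacent_def by (auto simp: abs_if split: if_splits) presburger+
  have "independent_points {p \<in> triangle_points a b c. white p}"
    "independent_points {p \<in> triangle_points a b c. black p}"
    unfolding independent_points_def white_def black_def using odd_step by fastforce+
  then show "max (card {p \<in> triangle_points a b c. white p})
      (card {p \<in> triangle_points a b c. black p})
      \<in> {card S | S. S \<subseteq> triangle_points a b c \<and> independent_points S}"
    unfolding max_def by auto
qed

end
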